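(* For all integers $m$ and $n$ with $2\le m\le n$, we have $\tau_3(P_m\square P_n)=10$.
   Context: $P_n$ is the path on $n$ vertices and $P_m\square P_n$ is the $m\times n$ grid graph, where $\square$ denotes the Cartesian product of graphs. $[k]=\{1,\dots,k\}$ and $\binom{[k]}{t}$ is the collection of all $t$-element subsets of $[k]$. $d(v,w)$ is the distance between $v$ and $w$. For a finite simple graph $G$ and positive integers $t,k$, a $t$-tone $k$-coloring of $G$ is a function $f:V(G)\to\binom{[k]}{t}$ such that $|f(v)\cap f(w)|<d(v,w)$ for all distinct $v,w\in V(G)$. The $t$-tone chromatic number $\tau_t(G)$ is the minimum $k$ such that $G$ has a $t$-tone $k$-coloring. *)

theory Defs
  imports "Graph_Theory.Graph_Theory" "HOL-Library.Ramsey"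
begin

text \<open>
  A finite simple graph is a \<^locale>\<open>pair_graph\<close>: a finite loop-free digraph whose arc relation
  is symmetric, so that an edge \<open>{u, v}\<close> is present as the two arcs \<open>(u, v)\<close> and \<open>(v, u)\<close>.
\<close>

definition path_graph :: "nat \<Rightarrow> nat pair_pre_digraph" where
  "path_graph n =
    \<lparr> pverts = {1..n},
      parcs = {(i, j). i \<in> {1..n} \<and> j \<in> {1..n} \<and> (j = i + 1 \<or> i = j + 1)} \<rparr>"

definition cartesian_product ::
  "'a pair_pre_digraph \<Rightarrow> 'b pair_pre_digraph \<Rightarrow> ('a \<times> 'b) pair_pre_digraph" (infixr "\<box>" 70) where
  "G \<box> H =
    \<lparr> pverts = pverts G \<times> pverts H,
      parcs = {((u, v), (u', v')).
                 (u = u' \<and> u \<in> pverts G \<and> (v, v') \<in> parcs H) \<or>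
                 ((u, u') \<in> parcs G \<and> v = v' \<and> v \<in> pverts H)} \<rparr>"

lemma pair_graph_path_graph: "pair_graph (path_graph n)"
proof unfold_locales
  show "finite (parcs (path_graph n))"
    by (rule finite_subset[of _ "{1..n} \<times> {1..n}"]) (auto simp: path_graph_def)
  show "symmetric (with_proj (path_graph n))"
    by (auto simp: path_graph_def symmetric_def arcs_ends_def arc_to_ends_def with_proj_def sym_def)
qed (auto simp: path_graph_def)

lemma pair_graph_cartesian_product:
  assumes "pair_graph G" and "pair_graph H"
  shows "pair_graph (G \<box> H)"
proof -
  interpret G: pair_graph G by fact
  interpret H: pair_graph H by fact
  have symG: "(v, u) \<in> parcs G" if "(u, v) \<in> parcs G" for u v
    using G.pair_sym_arcs that by (auto simp: symmetric_def dest: symD)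
  have symH: "(v, u) \<in> parcs H" if "(u, v) \<in> parcs H" for u v
    using H.pair_sym_arcs that by (auto simp: symmetric_def dest: symD)
  have sub: "parcs (G \<box> H) \<subseteq> pverts (G \<box> H) \<times> pverts (G \<box> H)"
    by (auto simp: cartesian_product_def dest: G.in_arcsD1 G.in_arcsD2 H.in_arcsD1 H.in_arcsD2)
  have fin: "finite (pverts (G \<box> H))"
    by (simp add: cartesian_product_def G.pair_finite_verts H.pair_finite_verts)
  show ?thesis
  proof unfold_locales
    show "finite (parcs (G \<box> H))"
      by (rule finite_subset[OF sub]) (simp add: fin)
    show "symmetric (with_proj (G \<box> H))"
      by (auto simp: symmetric_def sym_def cartesian_product_def symG symH)
  qed (use fin in \<open>auto simp: cartesian_product_def
         dest: G.no_loops' H.no_loops' G.in_arcsD1 G.in_arcsD2 H.in_arcsD1 H.in_arcsD2\<close>)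
qed

text \<open>
  Distance is the library's shortest-path cost with every arc of weight 1. It is extended-real
  valued, with value \<open>\<infinity>\<close> between different components.
\<close>

definition graph_dist :: "'a pair_pre_digraph \<Rightarrow> 'a \<Rightarrow> 'a \<Rightarrow> ereal" where
  "graph_dist G v w = wf_digraph.\<mu> (with_proj G) (\<lambda>_. 1) v w"

definition tone_coloring ::
  "nat \<Rightarrow> nat \<Rightarrow> 'a pair_pre_digraph \<Rightarrow> ('a \<Rightarrow> nat set) \<Rightarrow> bool" where
  "tone_coloring t k G f \<longleftrightarrow>
    f \<in> pverts G \<rightarrow> nsets {1..k} t \<and>
    (\<forall>v \<in> pverts G. \<forall>w \<in> pverts G. v \<noteq> w \<longrightarrow>
       ereal (real (card (f v \<inter> f w))) < graph_dist G v w)"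

definition tone_chromatic_number :: "nat \<Rightarrow> 'a pair_pre_digraph \<Rightarrow> nat" where
  "tone_chromatic_number t G = (LEAST k. 0 < k \<and> (\<exists>f. tone_coloring t k G f))"

lemma graph_dist_ge_1:
  assumes "pair_graph G" and "v \<noteq> w"
  shows "1 \<le> graph_dist G v w"
proof -
  interpret pair_graph G by fact
  have "ereal 1 \<le> ereal (awalk_cost (\<lambda>_. 1) p)" if "awalk v p w" for p
    using that assms(2)
    by (cases p) (auto simp: awalk_cost_def sum_list_triv awalk_Nil_iff)
  then show ?thesis
    unfolding graph_dist_def \<mu>_def by (intro INF_greatest) (auto simp: one_ereal_def)
qed

text \<open>Hence the set minimized over in \<^const>\<open>tone_chromatic_number\<close> is never empty.\<close>

lemma ex_tone_coloring:
  assumes "pair_graph G"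
  shows "\<exists>k > 0. \<exists>f. tone_coloring t k G f"
proof -
  interpret pair_graph G by fact
  obtain h :: "'a \<Rightarrow> nat" where h: "inj_on h (pverts G)"
    using finite_imp_inj_to_nat_seg[OF pair_finite_verts] by blast
  define f where "f v = {h v * t + 1..h v * t + t}" for v
  define k where "k = Suc (\<Sum>v \<in> pverts G. h v * t + t)"
  have "h v * t + t \<le> k" if "v \<in> pverts G" for v
    using member_le_sum[OF that, of "\<lambda>v. h v * t + t"] pair_finite_verts by (simp add: k_def)
  then have "f \<in> pverts G \<rightarrow> nsets {1..k} t"
    by (fastforce simp: f_def nsets_def)
  moreover have "ereal (real (card (f v \<inter> f w))) < graph_dist G v w"
    if "v \<in> pverts G" "w \<in> pverts G" "v \<noteq> w" for v w
  proof -
    have *: "{a * t + 1..a * t + t} \<inter> {b * t + 1..b * t + t} = {}" if "a < b" for a b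
    proof -
      have "a * t + t \<le> b * t" using that mult_le_mono1[of "Suc a" b t] by simp
      then show ?thesis by auto
    qed
    have "h v \<noteq> h w" using h that by (auto dest: inj_onD)
    then have "f v \<inter> f w = {}"
      using *[of "h v" "h w"] *[of "h w" "h v"] by (auto simp: f_def neq_iff)
    moreover have "0 < graph_dist G v w"
      by (rule less_le_trans[OF _ graph_dist_ge_1[OF assms that(3)]]) simp
    ultimately show ?thesis by (simp add: zero_ereal_def)
  qed
  ultimately show ?thesis
    unfolding tone_coloring_def by (intro exI[of _ k]) (auto simp: k_def)
qed

end

theory Submission
  imports Defs
begin

text \<open>
  Lower bound: on the 4-cycle formed by \<open>(1,1), (1,2), (2,2), (2,1)\<close> opposite vertices share at
  most one color, so each of the two opposite pairs uses at least five colors; adjacent vertices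
  share none, so these two sets of five are disjoint and at least ten colors occur.

  Upper bound: the whole integer grid has a periodic coloring with seven colors arranged in a
  cycle and three extra colors. The vertex \<open>(x, y)\<close> gets the two cyclically consecutive colors
  starting at position \<open>3x + 5y\<close> modulo 7, together with the extra color numbered \<open>x + y\<close>
  modulo 3. The number of colors shared by two vertices depends only on their difference vector,
  and it never exceeds three, so only the vectors of \<open>\<ell>\<^sub>1\<close>-norm 1, 2 and 3 need to be inspected
  (\<open>triple_overlap_less\<close>). Distances in the grid graph are
  bounded below by the \<open>\<ell>\<^sub>1\<close>-distance because every arc changes one coordinate by one
  (\<open>grid_dist_ge\<close>).
\<close>

lemma pverts_grid: "pverts (path_graph m \<box> path_graph n) = {1..m} \<times> {1..n}"
  by (simp add: cartesian_product_def path_graph_def)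

lemma parcs_grid_iff:
  "((x, y), (x', y')) \<in> parcs (path_graph m \<box> path_graph n) \<longleftrightarrow>
     x \<in> {1..m} \<and> x' \<in> {1..m} \<and> y \<in> {1..n} \<and> y' \<in> {1..n} \<and>
     \<bar>int x - int x'\<bar> + \<bar>int y - int y'\<bar> = 1"
  by (auto simp: cartesian_product_def path_graph_def)

lemma wf_digraph_grid: "wf_digraph (with_proj (path_graph m \<box> path_graph n))"
proof -
  interpret pair_graph "path_graph m \<box> path_graph n"
    by (intro pair_graph_cartesian_product pair_graph_path_graph)
  show ?thesis by unfold_locales
qed

section \<open>Distances in the grid\<close>

lemma grid_dist_ge:
  "ereal (real_of_int (\<bar>int x - int x'\<bar> + \<bar>int y - int y'\<bar>))
     \<le> graph_dist (path_graph m \<box> path_graph n) (x, y) (x', y')"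
proof -
  interpret wf_digraph "with_proj (path_graph m \<box> path_graph n)"
    by (rule wf_digraph_grid)
  have "\<bar>int x - int x'\<bar> + \<bar>int y - int y'\<bar> \<le> int (length p)"
    if "awalk (x, y) p (x', y')" for p
    using that
  proof (induction p arbitrary: x y)
    case Nil
    then show ?case by (simp add: awalk_Nil_iff)
  next
    case (Cons e p)
    obtain a b c d where e: "e = ((a, b), (c, d))" by (metis surj_pair)
    have "((x, y), (c, d)) \<in> parcs (path_graph m \<box> path_graph n)" "awalk (c, d) p (x', y')"
      using Cons.prems by (auto simp: awalk_Cons_iff e)
    then show ?case
      using Cons.IH[of c d] by (auto simp: parcs_grid_iff)
  qed
  then have "real_of_int (\<bar>int x - int x'\<bar> + \<bar>int y - int y'\<bar>) \<le> awalk_cost (\<lambda>_. 1) p"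
    if "awalk (x, y) p (x', y')" for p
    using that by (fastforce simp: awalk_cost_def sum_list_triv)
  then show ?thesis
    unfolding graph_dist_def \<mu>_def by (intro INF_greatest) auto
qed

lemma graph_dist_le_1:
  assumes "wf_digraph (with_proj G)" and "(u, v) \<in> parcs G"
  shows "graph_dist G u v \<le> 1"
proof -
  interpret wf_digraph "with_proj G" by fact
  have "awalk u [(u, v)] v"
    using assms(2) wellformed[of "(u, v)"] by (auto simp: awalk_def)
  then show ?thesis
    unfolding graph_dist_def
    using min_cost_le_walk_cost[of u "[(u, v)]" v "\<lambda>_. 1"]
    by (simp add: awalk_cost_def one_ereal_def)
qed

lemma graph_dist_le_2:
  assumes "wf_digraph (with_proj G)" and "(u, w) \<in> parcs G" and "(w, v) \<in> parcs G"
  shows "graph_dist G u v \<le> 2"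
proof -
  interpret wf_digraph "with_proj G" by fact
  have "awalk u [(u, w), (w, v)] v"
    using assms(2,3) wellformed[of "(u, w)"] wellformed[of "(w, v)"] by (auto simp: awalk_def)
  then show ?thesis
    unfolding graph_dist_def
    using min_cost_le_walk_cost[of u "[(u, w), (w, v)]" v "\<lambda>_. 1"]
    by (simp add: awalk_cost_def)
qed

section \<open>Lower bound\<close>

lemma tone_coloring_grid_ge_10:
  assumes "2 \<le> m" and "2 \<le> n" and f: "tone_coloring 3 k (path_graph m \<box> path_graph n) f"
  shows "10 \<le> k"
proof -
  let ?G = "path_graph m \<box> path_graph n"
  let ?A = "f (1, 1) \<union> f (2, 2)" and ?B = "f (1, 2) \<union> f (2, 1)"
  have sub: "f v \<subseteq> {1..k}" and fin: "finite (f v)" and card: "card (f v) = 3"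
    if "v \<in> pverts ?G" for v
    using f that by (auto simp: tone_coloring_def nsets_def)
  have V: "(1, 1) \<in> pverts ?G" "(1, 2) \<in> pverts ?G" "(2, 1) \<in> pverts ?G" "(2, 2) \<in> pverts ?G"
    using assms(1,2) by (auto simp: pverts_grid)
  have inter: "ereal (real (card (f v \<inter> f w))) < graph_dist ?G v w"
    if "v \<in> pverts ?G" "w \<in> pverts ?G" "v \<noteq> w" for v w
    using f that by (auto simp: tone_coloring_def)
  have disj: "f v \<inter> f w = {}" if "(v, w) \<in> parcs ?G" "v \<in> pverts ?G" "w \<in> pverts ?G" "v \<noteq> w"
    for v w
    using less_le_trans[OF inter[OF that(2-4)] graph_dist_le_1[OF wf_digraph_grid that(1)]]
      fin[OF that(2)] by (simp add: one_ereal_def)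
  have five: "5 \<le> card (f v \<union> f w)"
    if "(v, u) \<in> parcs ?G" "(u, w) \<in> parcs ?G" "v \<in> pverts ?G" "w \<in> pverts ?G" "v \<noteq> w" for u v w
  proof -
    have "card (f v \<inter> f w) < 2"
      using less_le_trans[OF inter[OF that(3-5)] graph_dist_le_2[OF wf_digraph_grid that(1,2)]]
      by simp
    then show ?thesis
      using card_Un_Int[OF fin[OF that(3)] fin[OF that(4)]] card[OF that(3)] card[OF that(4)]
      by simp
  qed
  have "5 \<le> card ?A"
    using assms(1,2) V by (intro five[of _ "(1, 2)"]) (auto simp: parcs_grid_iff)
  moreover have "5 \<le> card ?B"
    using assms(1,2) V by (intro five[of _ "(1, 1)"]) (auto simp: parcs_grid_iff)
  moreover have "?A \<inter> ?B = {}"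
    using disj[of "(1, 1)" "(1, 2)"] disj[of "(1, 1)" "(2, 1)"]
      disj[of "(2, 2)" "(1, 2)"] disj[of "(2, 2)" "(2, 1)"] assms(1,2) V
    by (auto simp: parcs_grid_iff)
  then have "card (?A \<union> ?B) = card ?A + card ?B"
    using V fin by (intro card_Un_disjoint) auto
  moreover have "card (?A \<union> ?B) \<le> card {1..k}"
    using V sub by (intro card_mono) auto
  ultimately show ?thesis by simp
qed

section \<open>A periodic coloring of the integer grid with ten colors\<close>

text \<open>
  The colors \<open>1..7\<close> form the cycle and \<open>8..10\<close> are the extra ones; \<open>a\<close> is the position on the cycle
  and \<open>s\<close> the index of the extra color.
\<close>

definition cyclic_triple :: "nat \<Rightarrow> nat \<Rightarrow> nat set" where
  "cyclic_triple a s = {1 + a mod 7, 1 + (a + 1) mod 7, 8 + s mod 3}"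

definition grid_coloring :: "nat \<times> nat \<Rightarrow> nat set" where
  "grid_coloring = (\<lambda>(x, y). cyclic_triple (3 * x + 5 * y) (x + y))"

text \<open>
  The number of colors shared by two triples whose cycle positions differ by \<open>i\<close> and whose extra
  indices differ by \<open>j\<close>; only the upper bound (\<open>card_cyclic_triple_Int\<close>) is used. The residues 1 and 6
  are the two ways in which consecutive pairs on the 7-cycle can overlap in one color.
\<close>

definition triple_overlap :: "int \<Rightarrow> int \<Rightarrow> nat" where
  "triple_overlap i j =
     (if i mod 7 = 0 then 2 else if i mod 7 \<in> {1, 6} then 1 else 0) + (if j mod 3 = 0 then 1 else 0)"

lemma cyclic_triple_in_nsets: "cyclic_triple a s \<in> nsets {1..10} 3"
proof -
  define r r' u where "r = a mod 7" and "r' = (a + 1) mod 7" and "u = s mod 3"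
  have "r < 7" "r' < 7" "u < 3" by (simp_all add: r_def r'_def u_def)
  moreover have "r' \<noteq> r" by (simp add: r_def r'_def mod_Suc)
  ultimately have "{1 + r, 1 + r', 8 + u} \<in> nsets {1..10} 3"
    by (simp add: nsets_def)
  then show ?thesis
    by (simp only: cyclic_triple_def r_def r'_def u_def)
qed

lemma card_cyclic_pair_Int:
  fixes a b :: nat
  shows "card ({1 + a mod 7, 1 + (a + 1) mod 7} \<inter> {1 + b mod 7, 1 + (b + 1) mod 7})
    \<le> (if (int a - int b) mod 7 = 0 then 2
        else if (int a - int b) mod 7 \<in> {1, 6} then 1 else 0)"
proof -
  define r q where "r = a mod 7" and "q = b mod 7"
  have "r < 7" "q < 7" by (simp_all add: r_def q_def)
  then have "r \<in> {0, 1, 2, 3, 4, 5, 6}" "q \<in> {0, 1, 2, 3, 4, 5, 6}" by auto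
  then have bound: "card ({1 + r, 1 + (r + 1) mod 7} \<inter> {1 + q, 1 + (q + 1) mod 7})
    \<le> (if (int r - int q) mod 7 = 0 then 2
        else if (int r - int q) mod 7 \<in> {1, 6} then 1 else 0)"
    by (elim insertE emptyE) simp_all
  have shift: "(r + 1) mod 7 = (a + 1) mod 7" "(q + 1) mod 7 = (b + 1) mod 7"
    unfolding r_def q_def by (rule mod_add_left_eq)+
  have diff: "(int r - int q) mod 7 = (int a - int b) mod 7"
    by (simp add: r_def q_def zmod_int mod_diff_eq)
  show ?thesis
    using bound unfolding shift diff unfolding r_def q_def .
qed

lemma card_cyclic_triple_Int:
  "card (cyclic_triple a s \<inter> cyclic_triple b t) \<le> triple_overlap (int a - int b) (int s - int t)"
proof -
  define P where "P c = {1 + c mod 7, 1 + (c + 1) mod 7}" for c :: nat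
  define E where "E = (if s mod 3 = t mod 3 then {8 + s mod 3} else {})"
  have split: "cyclic_triple c r = insert (8 + r mod 3) (P c)" for c r
    by (auto simp: cyclic_triple_def P_def)
  have bound: "z < 8" if "z \<in> P c" for z c
    using that by (auto simp: P_def)
  have "cyclic_triple a s \<inter> cyclic_triple b t \<subseteq> (P a \<inter> P b) \<union> E"
    by (auto simp: split E_def dest: bound)
  then have "card (cyclic_triple a s \<inter> cyclic_triple b t) \<le> card ((P a \<inter> P b) \<union> E)"
    by (rule card_mono[rotated]) (auto simp: P_def E_def)
  also have "\<dots> \<le> card (P a \<inter> P b) + card E"
    by (rule card_Un_le)
  also have "\<dots> \<le> triple_overlap (int a - int b) (int s - int t)"
    unfolding triple_overlap_def
  proof (rule add_mono)
    show "card (P a \<inter> P b) \<le> (if (int a - int b) mod 7 = 0 then 2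
        else if (int a - int b) mod 7 \<in> {1, 6} then 1 else 0)"
      unfolding P_def by (rule card_cyclic_pair_Int)
    have "s mod 3 = t mod 3 \<longleftrightarrow> int s mod 3 = int t mod 3"
      by (metis of_nat_eq_iff of_nat_mod of_nat_numeral)
    also have "\<dots> \<longleftrightarrow> (int s - int t) mod 3 = 0"
      by (simp add: mod_eq_dvd_iff mod_eq_0_iff_dvd)
    finally show "card E \<le> (if (int s - int t) mod 3 = 0 then 1 else 0)"
      by (simp add: E_def)
  qed
  finally show ?thesis .
qed

text \<open>
  Here \<open>(i, j)\<close> is the difference vector of two grid points, and its \<open>\<ell>\<^sub>1\<close>-norm exceeds the number of
  colors that the points share.
\<close>

lemma triple_overlap_less:
  fixes i j :: int
  assumes "(i, j) \<noteq> (0, 0)"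
  shows "int (triple_overlap (3 * i + 5 * j) (i + j)) < \<bar>i\<bar> + \<bar>j\<bar>"
proof (cases "\<bar>i\<bar> + \<bar>j\<bar> \<le> 3")
  case True
  then have "i \<in> {-3..3}" "j \<in> {-3..3}" by auto
  moreover have "{-3..3} = {-3, -2, -1, 0, 1, 2, 3 :: int}" by auto
  ultimately show ?thesis
    using assms True by (simp only: insert_iff empty_iff) (elim disjE; simp add: triple_overlap_def)
next
  case False
  then show ?thesis by (auto simp: triple_overlap_def)
qed

lemma tone_coloring_grid_coloring:
  "tone_coloring 3 10 (path_graph m \<box> path_graph n) grid_coloring"
  unfolding tone_coloring_def
proof (intro conjI ballI impI)
  show "grid_coloring \<in> pverts (path_graph m \<box> path_graph n) \<rightarrow> nsets {1..10} 3"
    using cyclic_triple_in_nsets by (auto simp del: One_nat_def simp: grid_coloring_def)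
next
  fix v w :: "nat \<times> nat"
  assume "v \<noteq> w"
  obtain x y x' y' where vw: "v = (x, y)" "w = (x', y')" by (metis surj_pair)
  define i j where "i = int x - int x'" and "j = int y - int y'"
  have eq: "int (3 * x + 5 * y) - int (3 * x' + 5 * y') = 3 * i + 5 * j"
    "int (x + y) - int (x' + y') = i + j"
    by (simp_all add: i_def j_def)
  have "card (grid_coloring v \<inter> grid_coloring w) \<le> triple_overlap (3 * i + 5 * j) (i + j)"
    using card_cyclic_triple_Int[of "3 * x + 5 * y" "x + y" "3 * x' + 5 * y'" "x' + y'"]
    unfolding eq by (simp add: vw grid_coloring_def)
  moreover have "int (triple_overlap (3 * i + 5 * j) (i + j)) < \<bar>i\<bar> + \<bar>j\<bar>"
    using \<open>v \<noteq> w\<close> by (intro triple_overlap_less) (auto simp: vw i_def j_def)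
  ultimately have "real (card (grid_coloring v \<inter> grid_coloring w)) < real_of_int (\<bar>i\<bar> + \<bar>j\<bar>)"
    by linarith
  then have "ereal (real (card (grid_coloring v \<inter> grid_coloring w)))
      < ereal (real_of_int (\<bar>i\<bar> + \<bar>j\<bar>))"
    by (simp only: less_ereal.simps)
  also have "\<dots> \<le> graph_dist (path_graph m \<box> path_graph n) v w"
    unfolding vw i_def j_def by (rule grid_dist_ge)
  finally show "ereal (real (card (grid_coloring v \<inter> grid_coloring w)))
      < graph_dist (path_graph m \<box> path_graph n) v w" .
qed

theorem theorem5p1:
  fixes m n :: nat
  assumes "2 \<le> m" and "m \<le> n"
  shows "tone_chromatic_number 3 (path_graph m \<box> path_graph n) = 10"
  unfolding tone_chromatic_number_def
proof (rule Least_equality)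
  show "0 < (10 :: nat) \<and> (\<exists>f. tone_coloring 3 10 (path_graph m \<box> path_graph n) f)"
    using tone_coloring_grid_coloring by auto
next
  fix k :: nat
  assume "0 < k \<and> (\<exists>f. tone_coloring 3 k (path_graph m \<box> path_graph n) f)"
  then show "10 \<le> k"
    using assms by (auto intro: tone_coloring_grid_ge_10[of m n])
qed

end
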